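(* Let $n\geq 4$ be an integer such that neither $n$ nor $n-1$ is a prime. If $n=p^l$ or $n=p^l+1$ for some integer $l\geq 2$ and some prime $p$, then $\operatorname{diam}(\Delta^o(S_n)^* )=3$.
   Context: $S_n$ is the symmetric group of degree $n$. For a finite group $G$, $o(g)$ denotes the order of $g\in G$, and the order super commuting graph $\Delta^o(G)$ is the simple undirected graph with vertex set $G$ in which two distinct elements $g,h$ are adjacent iff either $o(g)=o(h)$, or there exist $g',h'\in G$ with $o(g')=o(g)$, $o(h')=o(h)$ such that $g'$ and $h'$ are distinct and commute. A vertex is dominant if it is adjacent to every other vertex. The reduced order super commuting graph $\Delta^o(G)^*$ is the induced subgraph of $\Delta^o(G)$ obtained by deleting all dominant vertices of $\Delta^o(G)$. The diameter $\operatorname{diam}$ of a connected graph is the maximum distance between two of its vertices (saying the diameter equals $3$ includes that the graph is connected). *)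

theory Defs
  imports
    "HOL-Computational_Algebra.Primes"
    "HOL-Algebra.Sym_Groups"
    "HOL-Algebra.Multiplicative_Group"
    "Graph_Theory.Graph_Theory"
begin

text \<open>
  Following \<^theory>\<open>Graph_Theory.Digraph\<close>, simple undirected graphs are loop-free symmetric
  digraphs, so every edge is represented by its two orientations.
\<close>

definition order_super_commuting_arcs :: "('a, 'b) monoid_scheme \<Rightarrow> 'a rel" where
  "order_super_commuting_arcs G =
     {(g, h). g \<in> carrier G \<and> h \<in> carrier G \<and> g \<noteq> h \<and>
        (group.ord G g = group.ord G h \<or>
         (\<exists>g'\<in>carrier G. \<exists>h'\<in>carrier G.
            group.ord G g' = group.ord G g \<and> group.ord G h' = group.ord G h \<and>
            g' \<noteq> h' \<and> g' \<otimes>\<^bsub>G\<^esub> h' = h' \<otimes>\<^bsub>G\<^esub> g'))}"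

definition order_super_commuting_graph ::
    "('a, 'b) monoid_scheme \<Rightarrow> ('a, 'a \<times> 'a) pre_digraph" where
  "order_super_commuting_graph G =
     with_proj \<lparr> pverts = carrier G, parcs = order_super_commuting_arcs G \<rparr>"

definition dominant_verts :: "('a, 'b) pre_digraph \<Rightarrow> 'a set" where
  "dominant_verts D = {v \<in> verts D. \<forall>w \<in> verts D. w \<noteq> v \<longrightarrow> v \<rightarrow>\<^bsub>D\<^esub> w}"

definition reduced_order_super_commuting_graph ::
    "('a, 'b) monoid_scheme \<Rightarrow> ('a, 'a \<times> 'a) pre_digraph" where
  "reduced_order_super_commuting_graph G =
     (let D = order_super_commuting_graph G in D \<restriction> (verts D - dominant_verts D))"

text \<open>
  Distances are infinite between unreachable vertices.  The supremum in \<open>diameter\<close> is taken in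
  the extended reals; for a nonempty finite graph it is a maximum, and it is infinite iff the
  graph is not strongly connected.  For the graph without vertices it is \<open>- \<infinity>\<close>.
\<close>

context wf_digraph
begin

definition distance :: "'a \<Rightarrow> 'a \<Rightarrow> ereal" where
  "distance u v = \<mu> (\<lambda>_. 1) u v"

definition diameter :: ereal where
  "diameter = (SUP u \<in> verts G. SUP v \<in> verts G. distance u v)"

end

lemma graph_order_super_commuting_graph:
  assumes "finite (carrier G)"
  shows "graph (order_super_commuting_graph G)"
proof -
  have "order_super_commuting_arcs G \<subseteq> carrier G \<times> carrier G"
    by (auto simp: order_super_commuting_arcs_def)
  then have fin: "finite (order_super_commuting_arcs G)"
    using assms by (meson finite_SigmaI finite_subset)
  have "sym (order_super_commuting_arcs G)"
    unfolding order_super_commuting_arcs_def sym_def by clarsimp metis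
  then interpret pair_graph "\<lparr> pverts = carrier G, parcs = order_super_commuting_arcs G \<rparr>"
    using assms fin
    by unfold_locales (auto simp: symmetric_def order_super_commuting_arcs_def)
  show ?thesis
    unfolding order_super_commuting_graph_def by (rule pair_graphD_graph)
qed

lemma wf_digraph_reduced_order_super_commuting_graph:
  assumes "finite (carrier G)"
  shows "wf_digraph (reduced_order_super_commuting_graph G)"
proof -
  interpret graph "order_super_commuting_graph G"
    using assms by (rule graph_order_super_commuting_graph)
  show ?thesis
    unfolding reduced_order_super_commuting_graph_def Let_def
    by (rule wellformed_induce_subgraph)
qed

end

theory Submission
  imports Defs
begin

text \<open>
  If an element of \<open>S\<^sub>n\<close> has order divisible by pairwise coprime prime powers, then these sum to at
  most \<open>n\<close>; conversely, pairwise coprime numbers with sum at most \<open>n\<close> have their product as the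
  order of some element.  Hence elements of coprime orders \<open>a\<close> and \<open>b\<close> are adjacent only if \<open>a * b\<close>
  divides the order of some element.

  Upper bound: choose primes \<open>q\<close> and \<open>r\<close> dividing the orders of \<open>u\<close> and \<open>v\<close>.  If \<open>q = r\<close> or
  \<open>q + r \<le> n\<close>, powers of \<open>u\<close> and \<open>v\<close> of these orders give a path of length \<open>3\<close>.  If no such choice
  is possible, one of the elements, say \<open>u\<close>, has prime order, and the path runs through an element
  of order \<open>2\<close> and a power of \<open>v\<close>; here \<open>q, r \<le> n - 2\<close> is used.

  Lower bound: the elements adjacent to a \<open>p\<^sup>l\<close>-cycle have \<open>p\<close>-power order.  There is a set \<open>S\<close> of
  primes different from \<open>p\<close> with \<open>n - p < \<Sum>S \<le> n\<close>, and an element of order \<open>\<Prod>S\<close> is not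
  adjacent to any element of order divisible by \<open>p\<close>.  The set \<open>S\<close> exists because subset sums of
  primes have small gaps, as soon as each prime is bounded by the sum of the smaller ones; this
  follows from a weak form of Chebyshev's lower bound for the number of primes.
\<close>

section \<open>A lower bound for the number of primes\<close>

text \<open>For \<open>d = 1\<close> this is the recurrence of Leibniz's harmonic triangle with
  entries \<open>1 / ((k + 1) * (k choose m))\<close>. Absorption makes both binomials of the next
  row rational multiples of \<open>k choose m\<close>.\<close>

lemma Leibniz_harmonic_triangle:
  fixes d :: real
  assumes "m \<le> k"
  shows "d / (real (Suc (Suc k)) * real (Suc k choose Suc m)) =
         d / (real (Suc k) * real (k choose m)) - d / (real (Suc (Suc k)) * real (Suc k choose m))"
proof -
  define c where "c = real (k choose m)"
  have c: "c > 0"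
    using assms by (simp add: c_def)
  have "real (Suc m) * real (Suc k choose Suc m) = real (Suc k) * c"
    unfolding c_def using Suc_times_binomial[of m k] by (metis of_nat_mult)
  then have 1: "real (Suc k choose Suc m) = real (Suc k) * c / real (Suc m)"
    by (simp add: field_simps)
  have "(Suc k - m) * (Suc k choose m) = Suc k * (k choose m)"
    using binomial_absorb_comp[of "Suc k" m] by simp
  then have "real (Suc k - m) * real (Suc k choose m) = real (Suc k) * c"
    unfolding c_def by (metis of_nat_mult)
  moreover have "real (Suc k - m) > 0"
    using assms by simp
  ultimately have 2: "real (Suc k choose m) = real (Suc k) * c / real (Suc k - m)"
    by (simp add: field_simps)
  have 3: "real (Suc k - m) = real k + 1 - real m"
    using assms by simp
  show ?thesis
    unfolding 1 2 3 c_def[symmetric] using c assms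
    by (simp add: divide_simps) (simp add: algebra_simps)
qed

text \<open>Integrality holds in the column \<open>m = 0\<close> of the harmonic triangle scaled by
  \<open>D\<close>, and it spreads because each later entry is a difference of two entries of the
  previous column.\<close>

lemma Suc_times_binomial_dvd_common_multiple:
  assumes "m \<le> n" and "\<And>k. k \<in> {1..Suc n} \<Longrightarrow> k dvd D"
  shows "Suc n * (n choose m) dvd D"
proof -
  have "real D / (real (Suc n) * real (n choose m)) \<in> \<int>"
    using assms
  proof (induction m arbitrary: n)
    case 0
    then have "Suc n dvd D"
      by simp
    then obtain k where "D = Suc n * k"
      by (elim dvdE)
    then have "real D = real (Suc n) * real k"
      by (simp only: of_nat_mult)
    then have "real D / (real (Suc n) * real (n choose 0)) = real k"
      by (simp del: of_nat_Suc)
    then show ?case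
      by simp
  next
    case (Suc m)
    then obtain k where n: "n = Suc k"
      by (cases n) auto
    have "real D / (real (Suc k) * real (k choose m)) \<in> \<int>"
      using Suc.prems n by (intro Suc.IH) auto
    moreover have "real D / (real (Suc n) * real (n choose m)) \<in> \<int>"
      using Suc.prems n by (intro Suc.IH) auto
    ultimately have "real D / (real (Suc k) * real (k choose m)) -
        real D / (real (Suc n) * real (n choose m)) \<in> \<int>"
      by (rule Ints_diff)
    also have "real D / (real (Suc k) * real (k choose m)) - real D / (real (Suc n) * real (n choose m)) =
        real D / (real (Suc n) * real (n choose Suc m))"
      unfolding n using Leibniz_harmonic_triangle[of m k "real D"] Suc.prems(1) n by linarith
    finally show ?case .
  qed
  then obtain z where "real D / (real (Suc n) * real (n choose m)) = of_int z"
    by (auto elim: Ints_cases)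
  then have "real D = of_int z * (real (Suc n) * real (n choose m))"
    using assms(1) by (simp add: divide_eq_eq del: of_nat_Suc)
  then have "real_of_int (int D) = of_int (z * int (Suc n * (n choose m)))"
    by (simp only: of_int_of_nat_eq of_int_mult of_nat_mult)
  then have "int D = z * int (Suc n * (n choose m))"
    by (simp only: of_int_eq_iff)
  then have "int (Suc n * (n choose m)) dvd int D"
    by simp
  then show ?thesis
    by (simp only: int_dvd_int_iff)
qed

text \<open>The multiplicity of \<open>q\<close> in a nonzero lcm is the maximum over the members,
  so some member attains it. For \<open>e = 0\<close> the empty family, with lcm 1, would be a
  counterexample.\<close>

lemma prime_power_dvd_LcmD:
  fixes f :: "'a \<Rightarrow> nat"
  assumes "prime q" "finite A" "q ^ e dvd (LCM x\<in>A. f x)" "e > 0"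
  shows "\<exists>x\<in>A. q ^ e dvd f x"
  using assms(2,3)
proof (induction A)
  case empty
  then show ?case
    using assms(1,4) by (auto simp: prime_nat_iff)
next
  case (insert a A)
  show ?case
  proof (cases "f a = 0 \<or> (LCM x\<in>A. f x) = 0")
    case True
    then show ?thesis
      using insert by auto
  next
    case False
    then have "multiplicity q (lcm (f a) (LCM x\<in>A. f x)) =
        max (multiplicity q (f a)) (multiplicity q (LCM x\<in>A. f x))"
      using assms(1) by (simp add: multiplicity_lcm)
    moreover have "e \<le> multiplicity q (lcm (f a) (LCM x\<in>A. f x))"
      using insert.prems False assms(1)
      by (intro multiplicity_geI) (auto simp: lcm_eq_0_iff)
    ultimately have "e \<le> multiplicity q (f a) \<or> e \<le> multiplicity q (LCM x\<in>A. f x)"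
      by linarith
    then have "q ^ e dvd f a \<or> q ^ e dvd (LCM x\<in>A. f x)"
      by (auto intro: multiplicity_dvd')
    then show ?thesis
      using insert.IH by auto
  qed
qed

text \<open>Each maximal prime power in the lcm already divides some \<open>k \<le> n\<close>, so it
  is at most \<open>n\<close>, and there is at most one for each prime up to
  \<open>n\<close>.\<close>

lemma Lcm_upto_le:
  fixes n :: nat
  shows "Lcm {1..n} \<le> n ^ card {q. prime q \<and> q \<le> n}"
proof -
  let ?L = "Lcm {1..n}" and ?P = "{q. prime q \<and> q \<le> n}"
  have L: "?L > 0"
    by (auto simp: Lcm_0_iff intro!: Nat.gr0I)
  have pow: "q ^ multiplicity q ?L \<le> n \<and> q \<le> n" if q: "q \<in> prime_factors ?L" for q
  proof -
    have e: "multiplicity q ?L > 0"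
      using q by (simp add: prime_factors_multiplicity)
    have "prime q"
      using q by auto
    have "q ^ multiplicity q ?L dvd (LCM k\<in>{1..n}. k)"
      by (simp add: multiplicity_dvd)
    from prime_power_dvd_LcmD[OF \<open>prime q\<close> _ this e]
    obtain k where "k \<in> {1..n}" "q ^ multiplicity q ?L dvd k"
      by auto
    then have *: "q ^ multiplicity q ?L \<le> n"
      by (auto dest!: dvd_imp_le)
    moreover have "q ^ 1 \<le> q ^ multiplicity q ?L"
      using e prime_gt_0_nat[OF \<open>prime q\<close>] by (intro power_increasing) auto
    ultimately show ?thesis
      by simp
  qed
  have sub: "prime_factors ?L \<subseteq> ?P"
    using pow by (blast intro: in_prime_factors_imp_prime)
  have "?L = (\<Prod>q\<in>prime_factors ?L. q ^ multiplicity q ?L)"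
    by (rule prime_factorization_nat[OF L])
  also have "\<dots> \<le> (\<Prod>q\<in>prime_factors ?L. n)"
    by (intro prod_mono conjI pow[THEN conjunct1]) simp_all
  also have "\<dots> = n ^ card (prime_factors ?L)"
    by simp
  also have "\<dots> \<le> n ^ card ?P"
  proof (cases "n = 0")
    case False
    then show ?thesis
      using sub by (intro power_increasing card_mono) simp_all
  next
    case True
    then have "?P = {}"
      by auto
    then show ?thesis
      by (simp only: card.empty) (simp add: True)
  qed
  finally show ?thesis .
qed

text \<open>Nair's argument with \<open>2 * m = 2 ^ j\<close>: \<open>m * (2 * m choose m)\<close>
  divides the lcm of the numbers up to \<open>2 * m\<close>, while
  \<open>4 ^ m \<le> 2 * m * (2 * m choose m)\<close>. Both outer bounds are powers of 2, so
  comparing exponents suffices.\<close>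

lemma prime_count_lower_bound:
  "2 ^ j \<le> 1 + j * card {q::nat. prime q \<and> q \<le> 2 ^ j}"
proof (cases j)
  case (Suc i)
  define m :: nat where "m = 2 ^ i"
  have m: "m > 0" "2 * m = 2 ^ j"
    by (simp_all add: m_def Suc)
  let ?c = "card {q::nat. prime q \<and> q \<le> 2 ^ j}"
  have "Suc (2 * m - 1) * ((2 * m - 1) choose (m - 1)) dvd Lcm {1..2 * m}"
    using m by (intro Suc_times_binomial_dvd_common_multiple) (auto intro: dvd_Lcm)
  moreover have "Suc (2 * m - 1) * ((2 * m - 1) choose (m - 1)) = m * (2 * m choose m)"
    using m Suc_times_binomial[of "m - 1" "2 * m - 1"] by simp
  ultimately have "m * (2 * m choose m) \<le> Lcm {1..2 * m}"
    by (intro dvd_imp_le) (auto simp: Lcm_0_iff intro!: Nat.gr0I)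
  also have "\<dots> \<le> (2 * m) ^ ?c"
    using Lcm_upto_le[of "2 * m"] by (simp add: m)
  finally have "2 * m * (2 * m choose m) \<le> 2 * (2 * m) ^ ?c"
    by simp
  moreover have "4 ^ m \<le> real (2 * m * (2 * m choose m))"
    using central_binomial_lower_bound[of m] m(1) by (simp add: field_simps)
  then have "4 ^ m \<le> 2 * m * (2 * m choose m)"
    by (metis of_nat_le_iff of_nat_numeral of_nat_power)
  ultimately have "(4::nat) ^ m \<le> 2 * (2 * m) ^ ?c"
    by linarith
  also have "(4::nat) ^ m = 2 ^ (2 ^ j)"
    using power_mult[of "2::nat" 2 m] m by simp
  also have "2 * (2 * m) ^ ?c = 2 ^ (1 + j * ?c)"
    by (simp add: m power_mult)
  finally show ?thesis
    by (subst (asm) power_increasing_iff) simp_all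
qed simp

section \<open>The sum of the primes below a given number\<close>

text \<open>The maximum of \<open>k\<close> distinct positive integers is at least \<open>k\<close>;
  removing it leaves \<open>k - 1\<close> of them.\<close>

lemma gauss_sum_le_sum:
  fixes A :: "nat set"
  assumes "finite A" "0 \<notin> A"
  shows "card A * (card A + 1) \<le> 2 * \<Sum>A"
  using assms
proof (induction "card A" arbitrary: A)
  case (Suc k)
  then have "A \<noteq> {}"
    by auto
  define M where "M = Max A"
  have M: "M \<in> A"
    using Suc \<open>A \<noteq> {}\<close> by (simp add: M_def)
  have "A \<subseteq> {1..M}"
    using Suc.prems by (auto simp: M_def Suc_le_eq intro!: Nat.gr0I)
  then have "Suc k \<le> M"
    using card_mono[of "{1..M}" A] Suc.hyps(2) by simp
  moreover have "card (A - {M}) = k"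
    using M Suc by simp
  then have "k * (k + 1) \<le> 2 * \<Sum>(A - {M})"
    using Suc.hyps(1)[of "A - {M}"] Suc.prems by simp
  moreover have "\<Sum>A = M + \<Sum>(A - {M})"
    using M Suc.prems by (intro sum.remove) auto
  ultimately show ?case
    by (simp flip: Suc.hyps(2) add: algebra_simps)
qed simp

lemma six_square_le_two_power:
  assumes "9 \<le> j"
  shows "6 * j\<^sup>2 \<le> (2::nat) ^ j"
  using assms
proof (induction j rule: dec_induct)
  case (step j)
  have "9 * j \<le> j * j"
    using step.hyps by simp
  moreover have "(Suc j)\<^sup>2 = j * j + 2 * j + 1"
    by (simp add: power2_eq_square)
  ultimately have "(Suc j)\<^sup>2 \<le> 2 * j\<^sup>2"
    using step.hyps unfolding power2_eq_square by linarith
  then show ?case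
    using step.IH by simp
qed simp

text \<open>The slack 6 is what the induction step of \<open>odd_primes_subset_sums_dense\<close>
  requires; at \<open>x = 11\<close> there is equality,
  \<open>2 + 3 + 5 + 7 = 11 + 6\<close>.\<close>

lemma sum_primes_below_ge:
  fixes x :: nat
  assumes "11 \<le> x"
  shows "x + 6 \<le> \<Sum>{q. prime q \<and> q < x}"
proof -
  have mono: "\<Sum>T \<le> \<Sum>{q. prime q \<and> q < x}" if "\<forall>q\<in>T. prime q \<and> q < x" for T
    using that by (intro sum_mono2) auto
  \<comment> \<open>The upper ends are the sums of the primes listed below minus 6, and each
    interval begins right after its largest listed prime. Beyond 512 the prime count takes over,
    since then \<open>j \<ge> 9\<close>.\<close>
  consider "x = 11" | "12 \<le> x" "x \<le> 22" | "20 \<le> x" "x \<le> 71" | "38 \<le> x" "x \<le> 191"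
    | "68 \<le> x" "x \<le> 562" | "512 < x"
    using assms by linarith
  then show ?thesis
  proof cases
    case 1
    then show ?thesis
      using mono[of "{2, 3, 5, 7}"] by simp
  next
    case 2
    then show ?thesis
      using mono[of "{2, 3, 5, 7, 11}"] by simp
  next
    case 3
    then show ?thesis
      using mono[of "{2, 3, 5, 7, 11, 13, 17, 19}"] by simp
  next
    case 4
    then show ?thesis
      using mono[of "{2, 3, 5, 7, 11, 13, 17, 19, 23, 29, 31, 37}"] by simp
  next
    case 5
    then show ?thesis
      using mono[of "{2, 3, 5, 7, 11, 13, 17, 19, 23, 29, 31, 37, 41, 43, 47, 53, 59, 61, 67}"]
      by simp
  next
    case 6
    obtain j where j: "2 ^ j < x" "x \<le> 2 ^ Suc j"
    proof -
      have "\<exists>j. 2 ^ j < x \<and> x \<le> 2 ^ Suc j"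
        using ex_power_ivl2[of 2 x] assms by simp
      then show thesis
        using that by blast
    qed
    have "9 \<le> j"
    proof (rule ccontr)
      assume "\<not> 9 \<le> j"
      then have "(2::nat) ^ Suc j \<le> 2 ^ 9"
        by (intro power_increasing) auto
      then show False
        using j 6 by simp
    qed
    define X :: nat where "X = 2 ^ j"
    define c where "c = card {q::nat. prime q \<and> q \<le> X}"
    have X: "6 * j\<^sup>2 \<le> X"
      unfolding X_def using \<open>9 \<le> j\<close> by (rule six_square_le_two_power)
    have "81 \<le> j\<^sup>2"
      using power_mono[OF \<open>9 \<le> j\<close>, of 2] by simp
    \<comment> \<open>The aim is \<open>4 * X + 12 \<le> c\<^sup>2\<close>: Gauss's sum then yields
      at least \<open>2 * X + 6 \<ge> x + 6\<close>. The factor \<open>j\<^sup>2\<close> avoids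
      dividing \<open>X \<le> 1 + j * c\<close> by \<open>j\<close>.\<close>
    have "(4 * X + 12) * j\<^sup>2 \<le> c\<^sup>2 * j\<^sup>2"
    proof -
      have "X \<le> 1 + j * c"
        unfolding X_def c_def by (rule prime_count_lower_bound)
      then have "(X - 1) * (X - 1) \<le> (j * c) * (j * c)"
        by (intro mult_mono) auto
      moreover have "X * X \<le> (X - 1) * (X - 1) + 2 * X"
        by (cases X) auto
      \<comment> \<open>Of the six copies of \<open>X * j\<^sup>2\<close> that fit into
        \<open>X * X\<close>, four match the left side, one absorbs \<open>12 * j\<^sup>2\<close>
        and one \<open>2 * X\<close>.\<close>
      moreover have "(4 * X + 12) * j\<^sup>2 + 2 * X \<le> X * X"
      proof -
        have "12 * j\<^sup>2 \<le> X * j\<^sup>2"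
          using X \<open>81 \<le> j\<^sup>2\<close> by (intro mult_right_mono) auto
        moreover have "X * 2 \<le> X * j\<^sup>2"
          using \<open>81 \<le> j\<^sup>2\<close> by (intro mult_left_mono) auto
        moreover have "X * (6 * j\<^sup>2) \<le> X * X"
          using X by (intro mult_left_mono) auto
        moreover have "X * (6 * j\<^sup>2) = 6 * (X * j\<^sup>2)" "(4 * X + 12) * j\<^sup>2 = 4 * (X * j\<^sup>2) + 12 * j\<^sup>2"
          by (simp_all add: algebra_simps)
        ultimately show ?thesis
          by linarith
      qed
      ultimately have "(4 * X + 12) * j\<^sup>2 \<le> (j * c) * (j * c)"
        by linarith
      then show ?thesis
        by (simp add: power2_eq_square mult_ac)
    qed
    then have "4 * X + 12 \<le> c\<^sup>2"
      using \<open>9 \<le> j\<close> by simp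
    moreover have "c * (c + 1) \<le> 2 * \<Sum>{q::nat. prime q \<and> q \<le> X}"
      unfolding c_def by (intro gauss_sum_le_sum) auto
    moreover have "\<Sum>{q::nat. prime q \<and> q \<le> X} \<le> \<Sum>{q. prime q \<and> q < x}"
      using j by (intro mono) (auto simp: X_def)
    moreover have "x \<le> 2 * X"
      using j by (simp add: X_def)
    ultimately show ?thesis
      by (simp add: power2_eq_square)
  qed
qed

section \<open>Sums of distinct primes\<close>

text \<open>Richert's argument: if the subset sums of \<open>T\<close> leave no gap of length \<open>w\<close> in
  \<open>[a, B]\<close>, then adding a new summand \<open>q \<le> B + 1 - a\<close> extends the range to \<open>[a, B + q]\<close>.\<close>

definition subset_sums_dense :: "nat \<Rightarrow> nat \<Rightarrow> nat \<Rightarrow> nat set \<Rightarrow> bool" where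
  "subset_sums_dense w a B T \<longleftrightarrow> (\<forall>r\<in>{a..B}. \<exists>S\<subseteq>T. r < \<Sum>S + w \<and> \<Sum>S \<le> r)"

lemma subset_sums_dense_insert:
  assumes "subset_sums_dense w a B T" "finite T" "q \<notin> T" "a + q \<le> B + 1"
  shows "subset_sums_dense w a (B + q) (insert q T)"
  unfolding subset_sums_dense_def
proof
  fix r assume r: "r \<in> {a..B + q}"
  show "\<exists>S\<subseteq>insert q T. r < \<Sum>S + w \<and> \<Sum>S \<le> r"
  proof (cases "r \<le> B")
    case True
    then show ?thesis
      using r assms(1) unfolding subset_sums_dense_def by (meson atLeastAtMost_iff subset_insertI2)
  next
    case False
    \<comment> \<open>\<open>r > B\<close> and \<open>a + q \<le> B + 1\<close> place
      \<open>r - q\<close> back into the old range.\<close>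
    then have "r - q \<in> {a..B}" "q \<le> r"
      using r assms(4) by auto
    then obtain S where S: "S \<subseteq> T" "r - q < \<Sum>S + w" "\<Sum>S \<le> r - q"
      using assms(1) unfolding subset_sums_dense_def by blast
    have "finite S" "q \<notin> S"
      using S(1) assms(2,3) by (auto intro: finite_subset)
    then have "\<Sum>(insert q S) = q + \<Sum>S"
      by simp
    then show ?thesis
      using S \<open>q \<le> r\<close> by (intro exI[of _ "insert q S"]) auto
  qed
qed

lemma primes_below_Suc:
  "{q::nat. prime q \<and> q < Suc x} = (if prime x then insert x {q. prime q \<and> q < x} else {q. prime q \<and> q < x})"
  by (auto simp: less_Suc_eq)

text \<open>Sums of odd primes miss 1 and 2, so the range starts at 3. By complements the two values
  below the total are missed as well, so it stops 2 below the total of the odd primes, which is 4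
  below that of all primes.\<close>

lemma odd_primes_subset_sums_dense:
  fixes x :: nat
  assumes "11 \<le> x"
  shows "subset_sums_dense 2 3 (\<Sum>{q. prime q \<and> q < x} - 4) {q. prime q \<and> q < x \<and> q \<noteq> 2}"
  using assms
proof (induction x rule: dec_induct)
  case base
  have "q \<in> {2, 3, 5, 7}" if "prime q" "q < 11" for q :: nat
  proof -
    consider "q < 2" | "q \<in> {2, 3, 5, 7}" | "q \<in> {4, 6, 8, 9, 10}"
      using \<open>q < 11\<close> by force
    then show ?thesis
      using \<open>prime q\<close> prime_ge_2_nat[of q] by cases auto
  qed
  then have primes: "{q::nat. prime q \<and> q < 11} = {2, 3, 5, 7}"
    by auto
  have "{q::nat. prime q \<and> q < 11 \<and> q \<noteq> 2} = {q. prime q \<and> q < 11} - {2}"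
    by auto
  then have odd_primes: "{q::nat. prime q \<and> q < 11 \<and> q \<noteq> 2} = {3, 5, 7}"
    unfolding primes by simp
  have "\<exists>S\<subseteq>{3, 5, 7::nat}. r < \<Sum>S + 2 \<and> \<Sum>S \<le> r" if r: "r \<in> {3..13}" for r
  proof -
    consider "3 \<le> r" "r \<le> 4" | "5 \<le> r" "r \<le> 6" | "r = 7" | "8 \<le> r" "r \<le> 9"
      | "10 \<le> r" "r \<le> 11" | "12 \<le> r" "r \<le> 13"
      using r unfolding atLeastAtMost_iff by linarith
    then show ?thesis
    proof cases
      case 1
      then show ?thesis
        by (intro exI[of _ "{3}"]) auto
    next
      case 2
      then show ?thesis
        by (intro exI[of _ "{5}"]) auto
    next
      case 3
      then show ?thesis
        by (intro exI[of _ "{7}"]) auto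
    next
      case 4
      then show ?thesis
        by (intro exI[of _ "{3, 5}"]) auto
    next
      case 5
      then show ?thesis
        by (intro exI[of _ "{3, 7}"]) auto
    next
      case 6
      then show ?thesis
        by (intro exI[of _ "{5, 7}"]) auto
    qed
  qed
  then show ?case
    unfolding subset_sums_dense_def odd_primes primes by simp
next
  case (step x)
  let ?T = "{q. prime q \<and> q < x \<and> q \<noteq> 2}"
  show ?case
  proof (cases "prime x")
    case True
    have "x + 6 \<le> \<Sum>{q. prime q \<and> q < x}"
      using step.hyps by (intro sum_primes_below_ge)
    moreover have "{q. prime q \<and> q < Suc x \<and> q \<noteq> 2} = insert x ?T"
      using True step.hyps by auto
    moreover have "finite ?T" "x \<notin> ?T"
      by auto
    ultimately show ?thesis
      using subset_sums_dense_insert[OF step.IH, of x] True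
      by (simp add: primes_below_Suc add.commute)
  next
    case False
    then have "{q. prime q \<and> q < Suc x \<and> q \<noteq> 2} = ?T"
      by (auto simp: less_Suc_eq)
    then show ?thesis
      using step.IH False by (simp add: primes_below_Suc)
  qed
qed

text \<open>The empty sum covers \<open>r < p\<close>, and the full sum covers the last
  \<open>p\<close> values. A new prime \<open>x\<close> must not exceed the old sum plus
  \<open>p\<close>; for \<open>x > p\<close> that is the sum of all primes below
  \<open>x\<close>.\<close>

lemma primes_except_subset_sums_dense:
  fixes p x :: nat
  assumes "prime p" "p \<noteq> 2"
  shows "subset_sums_dense p 0 (\<Sum>{q. prime q \<and> q < x \<and> q \<noteq> p} + p - 1) {q. prime q \<and> q < x \<and> q \<noteq> p}"
proof (induction x)
  case 0
  show ?case
    using prime_gt_0_nat[OF assms(1)] by (auto simp: subset_sums_dense_def)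
next
  case (Suc x)
  let ?T = "{q. prime q \<and> q < x \<and> q \<noteq> p}"
  have fin: "finite ?T" "x \<notin> ?T"
    by auto
  have "p \<ge> 3"
    using assms prime_ge_2_nat[of p] by linarith
  show ?case
  proof (cases "prime x \<and> x \<noteq> p")
    case True
    have "x \<le> \<Sum>?T + p"
    proof (cases "x < p")
      case False
      then have "p < x" "3 < x"
        using True \<open>p \<ge> 3\<close> by auto
      \<comment> \<open>This would fail for \<open>x = 3\<close>, which \<open>x > p \<ge> 3\<close>
        excludes; for \<open>x = 5\<close> it is an equality.\<close>
      have "x \<le> \<Sum>{q. prime q \<and> q < x}"
      proof (cases "11 \<le> x")
        case large: True
        then show ?thesis
          using sum_primes_below_ge[of x] by simp
      next
        case small: False
        have "\<not> prime (4::nat)" "\<not> prime (6::nat)" "\<not> prime (8::nat)" "\<not> prime (9::nat)" "\<not> prime (10::nat)"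
          by simp_all
        moreover have "x \<in> {4, 5, 6, 7, 8, 9, 10}"
          using small \<open>3 < x\<close> by force
        ultimately have "x = 5 \<or> x = 7"
          using True by blast
        then have "\<Sum>(if x = 5 then {2, 3} else {2, 3, 5}) \<le> \<Sum>{q. prime q \<and> q < x}"
          by (intro sum_mono2) auto
        then show ?thesis
          using \<open>x = 5 \<or> x = 7\<close> by auto
      qed
      also have "{q. prime q \<and> q < x} = insert p ?T"
        using assms \<open>p < x\<close> by auto
      finally show ?thesis
        by simp
    qed simp
    moreover have "{q. prime q \<and> q < Suc x \<and> q \<noteq> p} = insert x ?T"
      using True by auto
    ultimately show ?thesis
      using subset_sums_dense_insert[OF Suc fin] \<open>p \<ge> 3\<close> by (simp add: add_ac)
  next
    case False
    then have "{q. prime q \<and> q < Suc x \<and> q \<noteq> p} = ?T"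
      by (auto simp: less_Suc_eq)
    then show ?thesis
      using Suc by simp
  qed
qed

text \<open>Disjoint cycles of the lengths in \<open>S\<close> leave fewer than \<open>p\<close>
  points, too few for a further \<open>p\<close>-cycle. For \<open>p = 2\<close> the attainable
  range starts at 3, whence \<open>3 \<le> n\<close>.\<close>

lemma prime_set_with_sum_near:
  fixes p n :: nat
  assumes "prime p" "3 \<le> n"
  shows "\<exists>S. finite S \<and> (\<forall>q\<in>S. prime q \<and> q \<noteq> p) \<and> \<Sum>S \<le> n \<and> n < \<Sum>S + p"
proof -
  \<comment> \<open>The 11 makes \<open>sum_primes_below_ge\<close> applicable and gives a prime sum
    of at least \<open>n + 17\<close>, so that either range contains \<open>n\<close>.\<close>
  define x where "x = n + 11"
  define P where "P = {q. prime q \<and> q < x}"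
  have P: "x + 6 \<le> \<Sum>P"
    unfolding P_def x_def by (rule sum_primes_below_ge) simp
  have "\<exists>a B. subset_sums_dense p a B {q. prime q \<and> q < x \<and> q \<noteq> p} \<and> a \<le> n \<and> n \<le> B"
  proof (cases "p = 2")
    case True
    have "subset_sums_dense p 3 (\<Sum>P - 4) {q. prime q \<and> q < x \<and> q \<noteq> p}"
      unfolding P_def True x_def by (rule odd_primes_subset_sums_dense) simp
    moreover have "n \<le> \<Sum>P - 4"
      using P by (simp add: x_def)
    ultimately show ?thesis
      using assms(2) by blast
  next
    case False
    let ?T = "{q. prime q \<and> q < x \<and> q \<noteq> p}"
    \<comment> \<open>\<open>p\<close> may lie beyond \<open>x\<close>, so in general only an
      inclusion holds.\<close>
    have "P \<subseteq> insert p ?T"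
      by (auto simp: P_def)
    then have "\<Sum>P \<le> \<Sum>(insert p ?T)"
      by (intro sum_mono2) auto
    then have "n \<le> \<Sum>?T + p - 1"
      using P by (simp add: x_def)
    then show ?thesis
      using primes_except_subset_sums_dense[OF assms(1) False, of x] by blast
  qed
  then obtain S where "S \<subseteq> {q. prime q \<and> q < x \<and> q \<noteq> p}" "n < \<Sum>S + p" "\<Sum>S \<le> n"
    unfolding subset_sums_dense_def by (meson atLeastAtMost_iff)
  then show ?thesis
    by (intro exI[of _ S]) (auto intro: finite_subset)
qed

section \<open>Orders of permutations\<close>

text \<open>\<open>a + b \<le> a * b\<close> for \<open>a, b \<ge> 2\<close>, with \<open>b\<close>
  the product of the remaining elements once there are any.\<close>

lemma sum_le_prod_ge_2:
  fixes A :: "nat set"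
  assumes "finite A" "\<forall>a\<in>A. 2 \<le> a"
  shows "\<Sum>A \<le> \<Prod>A"
  using assms
proof (induction A)
  case (insert a A)
  show ?case
  proof (cases "A = {}")
    case False
    then obtain b where "b \<in> A"
      by blast
    then have "2 \<le> b" "b dvd \<Prod>A"
      using insert by (auto intro: dvd_prodI)
    moreover have "\<Prod>A > 0"
      using insert by (intro prod_pos) fastforce
    ultimately have "2 \<le> \<Prod>A"
      by (meson dvd_imp_le order_trans)
    moreover have "2 \<le> a"
      using insert by simp
    ultimately have "a + \<Prod>A \<le> a * \<Prod>A"
      by (metis add_le_mono le_add_diff_inverse mult_2 mult_2_right mult_le_mono1 mult_le_mono2 nat_le_linear order_trans)
    then show ?thesis
      using insert by simp
  qed (use insert in simp)
qed simp

lemma prod_coprime_dvd: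
  fixes A :: "nat set"
  assumes "finite A" "pairwise coprime A" "\<forall>a\<in>A. a dvd m"
  shows "\<Prod>A dvd m"
  using assms
proof (induction A)
  case (insert a A)
  have "coprime a (\<Prod>A)"
    using insert.hyps insert.prems(1) by (intro prod_coprime_right) (auto simp: pairwise_insert)
  then show ?case
    using insert by (auto simp: pairwise_insert intro: divides_mult)
qed simp

lemma sym_group_nat_pow: "p [^]\<^bsub>sym_group n\<^esub> (k::nat) = p ^^ k"
proof -
  interpret group "sym_group n"
    by (rule sym_group_is_group)
  show ?thesis
    by (induction k) (simp_all add: sym_group_one sym_group_mult funpow_Suc_right del: funpow.simps(2))
qed

lemma sym_group_ord_eqI:
  assumes "p permutes {1..n}" "\<And>k. p ^^ k = id \<longleftrightarrow> d dvd k"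
  shows "group.ord (sym_group n) p = d"
  using assms by (subst group.ord_unique[OF sym_group_is_group])
    (auto simp: sym_group_nat_pow sym_group_one sym_group_carrier)

text \<open>\<open>least_power p x\<close> is the length of the cycle through \<open>x\<close>, and
  \<open>p ^^ k\<close> fixes \<open>x\<close> iff this length divides \<open>k\<close>.\<close>

lemma sym_group_ord_eq_Lcm:
  assumes "p permutes {1..n}"
  shows "group.ord (sym_group n) p = (LCM x\<in>{1..n}. least_power p x)"
proof (rule sym_group_ord_eqI[OF assms])
  fix k
  have perm: "permutation p"
    using assms by (auto simp: permutation_permutes)
  have "p ^^ k = id \<longleftrightarrow> (\<forall>x\<in>{1..n}. (p ^^ k) x = x)"
  proof
    assume *: "\<forall>x\<in>{1..n}. (p ^^ k) x = x"
    show "p ^^ k = id"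
    proof
      fix x
      show "(p ^^ k) x = id x"
        using * permutes_funpow[OF assms, of k] by (cases "x \<in> {1..n}") (auto simp: permutes_def)
    qed
  qed simp
  also have "\<dots> \<longleftrightarrow> (LCM x\<in>{1..n}. least_power p x) dvd k"
    by (simp add: Lcm_dvd_iff least_power_dvd[OF perm])
  finally show "p ^^ k = id \<longleftrightarrow> (LCM x\<in>{1..n}. least_power p x) dvd k" .
qed

text \<open>Each prime power dividing the order divides the length of some cycle, and the sum of the
  (at least \<open>2\<close>, pairwise coprime) prime powers assigned to one cycle is at most their product.\<close>

lemma sum_prime_powers_dvd_ord_le:
  assumes p: "p permutes {1..n}" and "finite Q" "pairwise coprime Q"
    and Q: "\<And>q. q \<in> Q \<Longrightarrow> \<exists>r e. prime r \<and> 0 < e \<and> q = r ^ e"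
    and dvd: "\<And>q. q \<in> Q \<Longrightarrow> q dvd group.ord (sym_group n) p"
  shows "\<Sum>Q \<le> n"
proof -
  have perm: "permutation p"
    using p by (auto simp: permutation_permutes)
  have "\<exists>x\<in>{1..n}. q dvd least_power p x" if q: "q \<in> Q" for q
  proof -
    obtain r e where "prime r" "0 < e" "q = r ^ e"
      using Q[OF q] by blast
    then show ?thesis
      using dvd[OF q] prime_power_dvd_LcmD[of r "{1..n}" e "least_power p"]
      by (simp add: sym_group_ord_eq_Lcm[OF p])
  qed
  then obtain c where c: "\<And>q. q \<in> Q \<Longrightarrow> c q \<in> {1..n} \<and> q dvd least_power p (c q)"
    by metis
  \<comment> \<open>Different \<open>q\<close> may pick different points of one cycle, so the
    grouping is by the point set of the cycle rather than by \<open>c q\<close>.\<close>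
  define C where "C q = set (support p (c q))" for q
  have card_C: "card (C q) = least_power p (c q)" for q
    unfolding C_def using cycle_of_permutation[OF perm, of "c q"] distinct_card by fastforce
  have "\<Sum>Q = (\<Sum>A\<in>C ` Q. \<Sum>{q \<in> Q. C q = A})"
    by (rule sum.image_gen) fact
  also have "\<dots> \<le> (\<Sum>A\<in>C ` Q. card A)"
  proof (rule sum_mono)
    fix A assume "A \<in> C ` Q"
    then obtain q0 where "q0 \<in> Q" "A = C q0"
      by blast
    then have "card A > 0"
      using least_power_of_permutation(2)[OF perm] by (simp add: card_C)
    have "2 \<le> q" if q: "q \<in> Q" for q
    proof -
      obtain r e where "prime r" "0 < e" "q = r ^ e"
        using Q[OF q] by blast
      then show ?thesis
        using prime_ge_2_nat[of r] self_le_power[of r e] by linarith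
    qed
    then have "\<Sum>{q \<in> Q. C q = A} \<le> \<Prod>{q \<in> Q. C q = A}"
      using \<open>finite Q\<close> by (intro sum_le_prod_ge_2) auto
    also have "\<dots> \<le> card A"
    proof (rule dvd_imp_le)
      show "\<Prod>{q \<in> Q. C q = A} dvd card A"
      proof (rule prod_coprime_dvd)
        show "\<forall>q\<in>{q \<in> Q. C q = A}. q dvd card A"
          using c card_C by auto
      qed (use \<open>finite Q\<close> \<open>pairwise coprime Q\<close> in \<open>auto simp: pairwise_def\<close>)
    qed fact
    finally show "\<Sum>{q \<in> Q. C q = A} \<le> card A" .
  qed
  also have "\<dots> = card (\<Union>(C ` Q))"
  proof (rule card_Union_disjoint[symmetric])
    have "C ` Q \<subseteq> range (\<lambda>a. set (support p a))"
      by (auto simp: C_def)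
    then show "pairwise disjnt (C ` Q)"
      using disjoint_support[OF perm] by (rule pairwise_subset[rotated])
  qed (auto simp: C_def)
  also have "\<dots> \<le> card {1..n}"
  proof (rule card_mono)
    show "\<Union>(C ` Q) \<subseteq> {1..n}"
    proof
      fix x assume "x \<in> \<Union>(C ` Q)"
      then obtain q i where "q \<in> Q" "x = (p ^^ i) (c q)"
        by (auto simp: C_def)
      then show "x \<in> {1..n}"
        using c permutes_in_image[OF permutes_funpow[OF p]] by metis
    qed
  qed simp
  finally show ?thesis
    by simp
qed

lemma two_prime_powers_dvd_ord_le:
  assumes "p permutes {1..n}" "prime q" "prime r" "q \<noteq> r" "0 < a" "0 < b"
    and "q ^ a dvd group.ord (sym_group n) p" "r ^ b dvd group.ord (sym_group n) p"
  shows "q ^ a + r ^ b \<le> n"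
proof -
  have coprime: "coprime (q ^ a) (r ^ b)"
    using assms by (simp add: primes_coprime)
  have "q ^ a \<noteq> 1"
    using assms prime_gt_1_nat[of q] by simp
  \<comment> \<open>Distinctness ensures that the sum over the set \<open>{q ^ a, r ^ b}\<close> has
    two terms.\<close>
  then have "q ^ a \<noteq> r ^ b"
    using coprime by (metis coprime_self nat_dvd_1_iff_1)
  moreover have "\<Sum>{q ^ a, r ^ b} \<le> n"
    using assms coprime
    by (intro sum_prime_powers_dvd_ord_le[of p]) (auto simp: pairwise_insert coprime_commute)
  ultimately show ?thesis
    by simp
qed

lemma prime_power_dvd_ord_le:
  assumes "p permutes {1..n}" "prime q" "0 < a" "q ^ a dvd group.ord (sym_group n) p"
  shows "q ^ a \<le> n"
proof -
  have "\<Sum>{q ^ a} \<le> n"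
    using assms by (intro sum_prime_powers_dvd_ord_le[of p]) auto
  then show ?thesis
    by simp
qed

section \<open>Permutations of prescribed order\<close>

text \<open>Powers of the cycle rotate \<open>cs\<close>, and a list of distinct entries is restored
  only by rotations through multiples of its length.\<close>

lemma cycle_of_list_funpow_eq_id_iff:
  assumes "distinct cs" "cs \<noteq> []"
  shows "cycle_of_list cs ^^ k = id \<longleftrightarrow> length cs dvd k"
proof
  assume "cycle_of_list cs ^^ k = id"
  then have "rotate k cs = cs"
    using cyclic_rotation[OF assms(1), of k] by simp
  then have "cs ! 0 = cs ! (k mod length cs)"
    using assms(2) nth_rotate[where n = 0 and xs = cs and m = k] by simp
  then show "length cs dvd k"
    using assms by (subst (asm) nth_eq_iff_index_eq) auto
next
  assume "length cs dvd k"
  then have *: "map (cycle_of_list cs ^^ k) cs = cs"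
    using cyclic_rotation[OF assms(1), of k] by (simp add: rotate_id)
  show "cycle_of_list cs ^^ k = id"
  proof
    fix x
    show "(cycle_of_list cs ^^ k) x = id x"
    proof (cases "x \<in> set cs")
      case True
      then show ?thesis
        using * by (metis id_apply list.map_id map_eq_conv)
    next
      case False
      then show ?thesis
        by (simp add: permutes_not_in[OF permutes_funpow[OF cycle_permutes]])
    qed
  qed
qed

lemma funpow_comp_disjoint_permutes_eq_id_iff:
  assumes f: "f permutes A" and g: "g permutes B" and disj: "A \<inter> B = {}"
  shows "(f \<circ> g) ^^ k = id \<longleftrightarrow> f ^^ k = id \<and> g ^^ k = id"
proof -
  have A: "((f \<circ> g) ^^ k) x = (f ^^ k) x" if "x \<in> A" for x
  proof (induction k)
    case (Suc k)
    have "(f ^^ k) x \<in> A"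
      using that permutes_in_image[OF permutes_funpow[OF f]] by blast
    then have "g ((f ^^ k) x) = (f ^^ k) x"
      using disj by (intro permutes_not_in[OF g]) blast
    then show ?case
      using Suc by simp
  qed simp
  have B: "((f \<circ> g) ^^ k) x = (g ^^ k) x" if "x \<in> B" for x
  proof (induction k)
    case (Suc k)
    have "(g ^^ Suc k) x \<in> B"
      using that permutes_in_image[OF permutes_funpow[OF g]] by blast
    then have "f ((g ^^ Suc k) x) = (g ^^ Suc k) x"
      using disj by (intro permutes_not_in[OF f]) blast
    then show ?case
      using Suc by simp
  qed simp
  have fA: "(f ^^ k) x = x" if "x \<notin> A" for x
    using that by (intro permutes_not_in[OF permutes_funpow[OF f]])
  have gB: "(g ^^ k) x = x" if "x \<notin> B" for x
    using that by (intro permutes_not_in[OF permutes_funpow[OF g]])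
  have C: "((f \<circ> g) ^^ k) x = x" if "x \<notin> A" "x \<notin> B" for x
    using that permutes_not_in[OF permutes_funpow[OF permutes_compose[of g "A \<union> B" f]]]
      permutes_subset[OF f] permutes_subset[OF g] by blast
  show ?thesis
    unfolding fun_eq_iff id_apply using A B C fA gB by metis
qed

text \<open>Cycles of the lengths in \<open>Q\<close> are laid on consecutive blocks. The order is
  expressed through \<open>f ^^ k = id\<close> because the ground set grows during the
  induction.\<close>

lemma ex_permutes_of_order_prod:
  fixes Q :: "nat set"
  assumes "finite Q" "pairwise coprime Q" "0 \<notin> Q"
  shows "\<exists>f. f permutes {1..\<Sum>Q} \<and> (\<forall>k. f ^^ k = id \<longleftrightarrow> \<Prod>Q dvd k)"
  using assms
proof (induction Q)
  case empty
  show ?case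
    by (auto simp: permutes_empty)
next
  case (insert q Q)
  define s where "s = \<Sum>Q"
  obtain f where f: "f permutes {1..s}" "\<And>k. f ^^ k = id \<longleftrightarrow> \<Prod>Q dvd k"
    using insert.IH insert.prems unfolding s_def pairwise_insert by blast
  define g where "g = cycle_of_list [s + 1..<s + 1 + q]"
  have "q > 0"
    using insert.prems by simp
  have set: "set [s + 1..<s + 1 + q] = {s + 1..s + q}"
    by auto
  have g: "g permutes {s + 1..s + q}" "g ^^ k = id \<longleftrightarrow> q dvd k" for k
    unfolding g_def using cycle_permutes[of "[s + 1..<s + 1 + q]"] set
      cycle_of_list_funpow_eq_id_iff[of "[s + 1..<s + 1 + q]" k] \<open>q > 0\<close> by simp_all
  have "coprime q (\<Prod>Q)"
    using insert.hyps insert.prems(1) by (intro prod_coprime_right) (auto simp: pairwise_insert)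
  then have "(f \<circ> g) ^^ k = id \<longleftrightarrow> q * \<Prod>Q dvd k" for k
    using funpow_comp_disjoint_permutes_eq_id_iff[OF f(1) g(1), of k] f(2) g(2)
    by (auto intro: divides_mult dest: dvd_mult_left dvd_mult_right)
  moreover have "f \<circ> g permutes {1..s + q}"
    using permutes_subset[OF f(1), of "{1..s + q}"] permutes_subset[OF g(1), of "{1..s + q}"]
    by (intro permutes_compose) auto
  moreover have "\<Sum>(insert q Q) = s + q" "\<Prod>(insert q Q) = q * \<Prod>Q"
    using insert.hyps by (simp_all add: s_def)
  ultimately show ?case
    by metis
qed

lemma ex_sym_group_ord_prod:
  fixes Q :: "nat set"
  assumes "finite Q" "pairwise coprime Q" "0 \<notin> Q" "\<Sum>Q \<le> n"
  shows "\<exists>f\<in>carrier (sym_group n). group.ord (sym_group n) f = \<Prod>Q"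
proof -
  obtain f where "f permutes {1..\<Sum>Q}" and pow: "\<And>k. f ^^ k = id \<longleftrightarrow> \<Prod>Q dvd k"
    using ex_permutes_of_order_prod[OF assms(1-3)] by blast
  then have f: "f permutes {1..n}"
    using assms(4) by (auto intro: permutes_subset)
  then show ?thesis
    using sym_group_ord_eqI[OF f pow] by (auto simp: sym_group_carrier)
qed

section \<open>The order super commuting graph\<close>

context group
begin

lemma ex_pow_ord_eq:
  assumes "z \<in> carrier G" "a dvd ord z" "ord z \<noteq> 0"
  obtains k :: nat where "ord (z [^] k) = a"
proof -
  obtain k where k: "ord z = a * k"
    using assms(2) by blast
  then have "ord (z [^] k) = a"
    using assms ord_pow[of z k] by auto
  then show thesis
    by (rule that)
qed

text \<open>Suitable powers of \<open>z\<close> have the two orders and commute. Should they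
  coincide, the orders agree and the first clause of adjacency applies.\<close>

lemma order_super_commuting_arcsI:
  assumes "u \<in> carrier G" "v \<in> carrier G" "u \<noteq> v" "z \<in> carrier G" "ord z \<noteq> 0"
    and "ord u dvd ord z" "ord v dvd ord z"
  shows "(u, v) \<in> order_super_commuting_arcs G"
proof -
  obtain i j :: nat where ij: "ord (z [^] i) = ord u" "ord (z [^] j) = ord v"
    using assms ex_pow_ord_eq by metis
  moreover have "z [^] i \<otimes> z [^] j = z [^] j \<otimes> z [^] i"
    using assms(4) by (simp add: nat_pow_mult add.commute)
  moreover have "z [^] i \<noteq> z [^] j \<or> ord u = ord v"
    using ij by metis
  ultimately show ?thesis
    using assms unfolding order_super_commuting_arcs_def by auto
qed

text \<open>A power \<open>w\<close> of order \<open>a\<close> of one commuting witness is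
  multiplied by the other witness \<open>y\<close>; by coprimality both orders divide that of the
  product.\<close>

lemma order_super_commuting_arcsD:
  assumes "(u, v) \<in> order_super_commuting_arcs G"
    and "a dvd ord u" "coprime a (ord v)" "ord u \<noteq> 0"
  obtains z where "z \<in> carrier G" "a dvd ord z" "ord v dvd ord z"
proof (cases "ord u = ord v")
  case True
  then have "a = 1"
    using assms coprime_common_divisor_nat[of a "ord v" a] by auto
  then show thesis
    using that[of v] assms(1) by (simp add: order_super_commuting_arcs_def)
next
  case False
  then obtain x y where xy: "x \<in> carrier G" "y \<in> carrier G" "ord x = ord u" "ord y = ord v"
      "x \<otimes> y = y \<otimes> x"
    using assms(1) unfolding order_super_commuting_arcs_def by auto
  obtain i :: nat where i: "ord (x [^] i) = a"
    using ex_pow_ord_eq[of x a] xy assms by auto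
  define w where "w = x [^] i"
  have w: "w \<in> carrier G" "ord w = a" "w \<otimes> y = y \<otimes> w"
    using xy i unfolding w_def by (auto simp: group_commutes_pow)
  define z where "z = w \<otimes> y"
  have z: "z \<in> carrier G"
    using w xy by (simp add: z_def)
  \<comment> \<open>\<open>m = ord v\<close> will eliminate the factor \<open>y\<close> and
    \<open>m = a\<close> the factor \<open>w\<close>; coprimality then cancels \<open>m\<close> from
    each divisibility.\<close>
  have pow: "w [^] (ord z * m) \<otimes> y [^] (ord z * m) = \<one>" for m
  proof -
    have "z [^] (ord z * m) = \<one>"
      using z by (simp add: pow_eq_id)
    then show ?thesis
      unfolding z_def using pow_mult_distrib[OF w(3,1) xy(2)] by metis
  qed
  have "a dvd ord z * ord v"
    using pow[of "ord v"] w xy pow_eq_id[of y "ord z * ord v"] pow_eq_id[of w "ord z * ord v"] by simp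
  then have "a dvd ord z"
    using assms(3) by (simp add: coprime_dvd_mult_left_iff)
  moreover have "ord v dvd ord z * a"
    using pow[of a] w xy pow_eq_id[of y "ord z * a"] pow_eq_id[of w "ord z * a"] by simp
  then have "ord v dvd ord z"
    using assms(3) by (simp add: coprime_dvd_mult_left_iff coprime_commute)
  ultimately show thesis
    using that z by blast
qed

end

section \<open>Distances in the reduced graph\<close>

context wf_digraph
begin

lemma awalk_cost_unit: "awalk_cost (\<lambda>_. 1) p = real (length p)"
  by (induction p) auto

lemma ex_awalk_length_le_1:
  assumes "u \<in> verts G" "u = v \<or> u \<rightarrow> v"
  obtains p where "awalk u p v" "length p \<le> 1"
proof (cases "u = v")
  case True
  then show thesis
    using that[of "[]"] assms(1) by (simp add: awalk_Nil_iff)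
next
  case False
  then obtain e where "e \<in> arcs G" "tail G e = u" "head G e = v"
    using assms(2) by (auto simp: arcs_ends_def arc_to_ends_def)
  then show thesis
    using that[of "[e]"] by (auto simp: awalk_simps)
qed

lemma ex_awalk_length_le_3:
  assumes "u \<in> verts G" "w \<in> verts G" "w' \<in> verts G"
    and "u = w \<or> u \<rightarrow> w" "w = w' \<or> w \<rightarrow> w'" "w' = v \<or> w' \<rightarrow> v"
  shows "\<exists>p. awalk u p v \<and> length p \<le> 3"
proof -
  obtain p1 p2 p3 where "awalk u p1 w" "awalk w p2 w'" "awalk w' p3 v"
    "length p1 \<le> 1" "length p2 \<le> 1" "length p3 \<le> 1"
    using assms ex_awalk_length_le_1 by metis
  then show ?thesis
    by (intro exI[of _ "p1 @ p2 @ p3"]) (auto intro!: awalk_appendI simp del: awalk_append_iff)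
qed

lemma distance_le_length:
  assumes "awalk u p v"
  shows "distance u v \<le> ereal (length p)"
  unfolding distance_def using min_cost_le_walk_cost[OF assms, of "\<lambda>_. 1"]
  by (simp add: awalk_cost_unit)

lemma three_le_distance:
  assumes "u \<noteq> v" "\<not> u \<rightarrow> v" "\<And>w. u \<rightarrow> w \<Longrightarrow> \<not> w \<rightarrow> v"
  shows "3 \<le> distance u v"
  unfolding distance_def \<mu>_def
proof (rule INF_greatest)
  fix p assume "p \<in> {p. awalk u p v}"
  then have p: "awalk u p v"
    by simp
  have arc: "tail G e \<rightarrow> head G e" if "e \<in> arcs G" for e
    using that by (rule in_arcs_imp_in_arcs_ends)
  have "3 \<le> length p"
  proof (rule ccontr)
    assume "\<not> 3 \<le> length p"
    \<comment> \<open>\<open>remdups_adj.cases\<close> serves only as the case split into lists of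
      length 0, 1 and at least 2.\<close>
    then consider "p = []" | e where "p = [e]" | e e' where "p = [e, e']"
      by (cases p rule: remdups_adj.cases) (auto simp: Suc_le_eq numeral_eq_Suc)
    then show False
    proof cases
      case 1
      then show ?thesis
        using p assms(1) by (simp add: awalk_Nil_iff)
    next
      case 2
      then show ?thesis
        using p assms(2) arc by (auto simp: awalk_simps)
    next
      case 3
      then show ?thesis
        using p assms(3) arc[of e] arc[of e'] by (auto simp: awalk_simps)
    qed
  qed
  then show "3 \<le> ereal (awalk_cost (\<lambda>_. 1) p)"
    by (simp add: awalk_cost_unit)
qed

lemma connected_and_diameter_eq_3I:
  assumes short: "\<And>u v. u \<in> verts G \<Longrightarrow> v \<in> verts G \<Longrightarrow> \<exists>p. awalk u p v \<and> length p \<le> 3"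
    and uv: "u \<in> verts G" "v \<in> verts G" and far: "3 \<le> distance u v"
  shows "connected G \<and> diameter = 3"
proof
  show "connected G"
  proof (rule connectedI)
    fix x y assume "x \<in> verts G" "y \<in> verts G"
    then obtain p where "awalk x p y"
      using short by blast
    then show "x \<rightarrow>\<^sup>*\<^bsub>mk_symmetric G\<^esub> y"
      by (intro reachable_mk_symmetricI reachable_awalkI)
  qed (use uv in auto)
  have "distance x y \<le> 3" if xy: "x \<in> verts G" "y \<in> verts G" for x y
  proof -
    obtain p where "awalk x p y" "length p \<le> 3"
      using short xy by blast
    then show ?thesis
      using distance_le_length[of x p y] by (metis ereal_less_eq(3) of_nat_le_iff of_nat_numeral order_trans numeral_eq_ereal)
  qed
  moreover have "3 \<le> diameter"
    unfolding diameter_def using far uv by (meson SUP_upper2)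
  ultimately show "diameter = 3"
    by (intro antisym) (auto simp: diameter_def intro!: SUP_least)
qed

end

section \<open>Vertices and arcs of the reduced graph\<close>

lemma order_super_commuting_graph_simps [simp]:
  "verts (order_super_commuting_graph G) = carrier G"
  "arcs_ends (order_super_commuting_graph G) = order_super_commuting_arcs G"
  by (simp_all add: order_super_commuting_graph_def)

lemma verts_reduced_order_super_commuting_graph:
  "verts (reduced_order_super_commuting_graph G) =
     carrier G - dominant_verts (order_super_commuting_graph G)"
  by (simp add: reduced_order_super_commuting_graph_def Let_def)

lemma arcs_ends_reduced_order_super_commuting_graph:
  "u \<rightarrow>\<^bsub>reduced_order_super_commuting_graph G\<^esub> v \<longleftrightarrow>
     u \<in> verts (reduced_order_super_commuting_graph G) \<and>
     v \<in> verts (reduced_order_super_commuting_graph G) \<and> (u, v) \<in> order_super_commuting_arcs G"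
  by (force simp: reduced_order_super_commuting_graph_def Let_def order_super_commuting_graph_def
      arcs_ends_def arc_to_ends_def with_proj_def induce_subgraph_def)

lemma order_super_commuting_arcs_sym:
  "(u, v) \<in> order_super_commuting_arcs G \<Longrightarrow> (v, u) \<in> order_super_commuting_arcs G"
  unfolding order_super_commuting_arcs_def by clarsimp metis

lemma (in group) one_dominant:
  "\<one> \<in> dominant_verts (order_super_commuting_graph G)"
proof -
  have "\<exists>g'\<in>carrier G. \<exists>h'\<in>carrier G. ord g' = ord \<one> \<and> ord h' = ord w \<and>
      g' \<noteq> h' \<and> g' \<otimes> h' = h' \<otimes> g'" if "w \<in> carrier G" "w \<noteq> \<one>" for w
    using that by (intro bexI[of _ \<one>] bexI[of _ w]) auto
  then have "(\<one>, w) \<in> order_super_commuting_arcs G" if "w \<in> carrier G" "w \<noteq> \<one>" for w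
    using that by (simp add: order_super_commuting_arcs_def)
  then show ?thesis
    by (simp add: dominant_verts_def)
qed

section \<open>Walks of length at most three between non-identity permutations\<close>

lemma sym_group_ord_pos:
  assumes "u \<in> carrier (sym_group n)"
  shows "0 < group.ord (sym_group n) u"
proof -
  have "finite (carrier (sym_group n))"
    by (simp add: sym_group_def finite_permutations)
  then show ?thesis
    using group.ord_ge_1[OF sym_group_is_group _ assms] by fastforce
qed

text \<open>The assumptions on \<open>n\<close> and \<open>n - 1\<close> exclude the two largest
  values of \<open>q\<close>; the points left over give room for a transposition disjoint from a
  \<open>q\<close>-cycle.\<close>

lemma prime_dvd_sym_group_ord_le:
  assumes "u \<in> carrier (sym_group n)" "\<not> prime n" "\<not> prime (n - 1)"
    and "prime q" "q dvd group.ord (sym_group n) u"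
  shows "q + 2 \<le> n"
proof -
  have "q \<le> n"
    using prime_power_dvd_ord_le[of u n q 1] assms by (simp add: sym_group_carrier)
  moreover have "q \<noteq> n" "q \<noteq> n - 1"
    using assms by auto
  ultimately show ?thesis
    by linarith
qed

text \<open>Let a prime \<open>q'\<close> divide the cofactor of \<open>q\<close>. If
  \<open>q' = q\<close>, then \<open>2 * q \<le> q * q \<le> n < q + r\<close>; otherwise
  \<open>q + q' \<le> n < q' + r\<close>. Both contradict \<open>r \<le> q\<close>.\<close>

lemma sym_group_ord_eq_prime:
  assumes u: "u \<in> carrier (sym_group n)"
    and q: "prime q" "q dvd group.ord (sym_group n) u" and r: "prime r" "r \<le> q" "n < q + r"
    and far: "\<And>q'. prime q' \<Longrightarrow> q' dvd group.ord (sym_group n) u \<Longrightarrow> n < q' + r"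
  shows "group.ord (sym_group n) u = q"
proof (rule ccontr)
  let ?o = "group.ord (sym_group n) u"
  assume "?o \<noteq> q"
  obtain m where m: "?o = q * m"
    using q by blast
  then have "m \<noteq> 1"
    using \<open>?o \<noteq> q\<close> by auto
  then obtain q' where q': "prime q'" "q' dvd m"
    using prime_factor_nat by blast
  show False
  proof (cases "q' = q")
    case True
    then have "q ^ 2 dvd ?o"
      using q' m by (auto simp: power2_eq_square)
    then have "q * q \<le> n"
      using prime_power_dvd_ord_le[of u n q 2] u q
      by (simp add: sym_group_carrier power2_eq_square)
    moreover have "2 * q \<le> q * q"
      using prime_ge_2_nat[OF q(1)] by simp
    ultimately show ?thesis
      using r by linarith
  next
    case False
    then have "q + q' \<le> n"
      using two_prime_powers_dvd_ord_le[of u n q q' 1 1] u q q' m by (simp add: sym_group_carrier)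
    moreover have "n < q' + r"
      using far[of q'] q' m by simp
    ultimately show ?thesis
      using r by linarith
  qed
qed

text \<open>If no prime of \<open>ord u\<close> is compatible with one of \<open>ord v\<close>, pick
  any prime from each: the larger one is the whole order of its element.\<close>

lemma sym_group_ord_prime_cases:
  assumes u: "u \<in> carrier (sym_group n)" "u \<noteq> id" and v: "v \<in> carrier (sym_group n)" "v \<noteq> id"
  obtains q r where "prime q" "q dvd group.ord (sym_group n) u"
      "prime r" "r dvd group.ord (sym_group n) v" "q = r \<or> q + r \<le> n"
  | "prime (group.ord (sym_group n) u)" | "prime (group.ord (sym_group n) v)"
proof -
  interpret group "sym_group n"
    by (rule sym_group_is_group)
  have "ord u \<noteq> 1" "ord v \<noteq> 1"
    using u v by (simp_all only: ord_eq_1 sym_group_one not_False_eq_True)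
  then obtain q r where q: "prime q" "q dvd ord u" and r: "prime r" "r dvd ord v"
    using prime_factor_nat by metis
  show thesis
  proof (cases "\<exists>q r. prime q \<and> q dvd ord u \<and> prime r \<and> r dvd ord v \<and> (q = r \<or> q + r \<le> n)")
    case True
    then show thesis
      using that(1) by blast
  next
    case False
    then have far: "n < q + r" if "prime q" "q dvd ord u" "prime r" "r dvd ord v" for q r
      using that by (meson not_less)
    show thesis
    proof (cases "r \<le> q")
      case True
      then have "ord u = q"
        using sym_group_ord_eq_prime[OF u(1) q r(1) True] far q r by blast
      then show thesis
        using that(2) q by simp
    next
      case False
      then have "ord v = r"
        using sym_group_ord_eq_prime[OF v(1) r q(1), unfolded add.commute[of _ q]] far q r by auto
      then show thesis
        using that(3) r by simp
    qed
  qed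
qed

text \<open>For \<open>q \<noteq> r\<close>, disjoint cycles of these lengths give an element of
  order \<open>q * r\<close>.\<close>

lemma sym_group_arcs_coprimeI:
  assumes u: "u \<in> carrier (sym_group n)" and v: "v \<in> carrier (sym_group n)"
    and ord: "group.ord (sym_group n) u = q" "group.ord (sym_group n) v = r"
    and q: "prime q" and r: "prime r" and le: "q = r \<or> q + r \<le> n"
  shows "u = v \<or> (u, v) \<in> order_super_commuting_arcs (sym_group n)"
proof (cases "q = r")
  case True
  then show ?thesis
    using assms by (auto simp: order_super_commuting_arcs_def)
next
  case False
  interpret group "sym_group n"
    by (rule sym_group_is_group)
  have "\<exists>z\<in>carrier (sym_group n). ord z = \<Prod>{q, r}"
    using False q r le
    by (intro ex_sym_group_ord_prod) (auto simp: pairwise_insert primes_coprime)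
  then obtain z where z: "z \<in> carrier (sym_group n)" "ord z = q * r"
    using False by auto
  moreover have "q * r \<noteq> 0"
    using q r by auto
  ultimately show ?thesis
    using order_super_commuting_arcsI[OF u v _ z(1)] ord by (cases "u = v") simp_all
qed

lemma sym_group_prime_power_elem:
  assumes u: "u \<in> carrier (sym_group n)" and q: "prime q" "q dvd group.ord (sym_group n) u"
  obtains w where "w \<in> carrier (sym_group n)" "group.ord (sym_group n) w = q"
    "(u, w) \<in> order_super_commuting_arcs (sym_group n) \<or> u = w"
proof -
  interpret group "sym_group n"
    by (rule sym_group_is_group)
  have pos: "ord u \<noteq> 0"
    using sym_group_ord_pos[OF u] by simp
  obtain k :: nat where k: "ord (u [^]\<^bsub>sym_group n\<^esub> k) = q"
    using ex_pow_ord_eq[OF u q(2) pos] by blast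
  show thesis
    using that[OF _ k] k u q(2) order_super_commuting_arcsI[OF u _ _ u pos] by fastforce
qed

text \<open>Vertices may repeat, so shorter walks are included. The inner ones avoid
  \<open>id\<close>, which is deleted as a dominant vertex.\<close>

lemma sym_group_chain:
  assumes n: "\<not> prime n" "\<not> prime (n - 1)"
    and u: "u \<in> carrier (sym_group n)" "u \<noteq> id" and v: "v \<in> carrier (sym_group n)" "v \<noteq> id"
  shows "\<exists>w\<in>carrier (sym_group n) - {id}. \<exists>w'\<in>carrier (sym_group n) - {id}.
    (u = w \<or> (u, w) \<in> order_super_commuting_arcs (sym_group n)) \<and>
    (w = w' \<or> (w, w') \<in> order_super_commuting_arcs (sym_group n)) \<and>
    (w' = v \<or> (w', v) \<in> order_super_commuting_arcs (sym_group n))"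
proof -
  interpret group "sym_group n"
    by (rule sym_group_is_group)
  let ?E = "order_super_commuting_arcs (sym_group n)"
  have sym: "(b, a) \<in> ?E" if "(a, b) \<in> ?E" for a b
    using that by (rule order_super_commuting_arcs_sym)
  have nonid: "w \<noteq> id" if "prime (ord w)" for w
    using that ord_id by (auto simp: sym_group_one)
  \<comment> \<open>The chain is \<open>u, t, w', v\<close> with \<open>t\<close> of order 2 and
    \<open>w'\<close> of prime order \<open>r\<close> dividing \<open>ord v\<close>; both
    \<open>ord u\<close> and \<open>r\<close> are at most \<open>n - 2\<close>.\<close>
  have prime_case: "\<exists>w\<in>carrier (sym_group n) - {id}. \<exists>w'\<in>carrier (sym_group n) - {id}.
      (u = w \<or> (u, w) \<in> ?E) \<and> (w = w' \<or> (w, w') \<in> ?E) \<and> (w' = v \<or> (w', v) \<in> ?E)"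
    if u: "u \<in> carrier (sym_group n)" "prime (ord u)" and v: "v \<in> carrier (sym_group n)" "v \<noteq> id"
    for u v
  proof -
    have q: "ord u + 2 \<le> n"
      using prime_dvd_sym_group_ord_le[OF u(1) n u(2)] by simp
    have "ord v \<noteq> 1"
      using v by (simp only: ord_eq_1 sym_group_one not_False_eq_True)
    then obtain r where r: "prime r" "r dvd ord v"
      using prime_factor_nat by metis
    have r2: "r + 2 \<le> n"
      using prime_dvd_sym_group_ord_le[OF v(1) n r] .
    have "\<exists>t\<in>carrier (sym_group n). ord t = \<Prod>{2}"
      using q by (intro ex_sym_group_ord_prod) auto
    then obtain t where t: "t \<in> carrier (sym_group n)" "ord t = 2"
      by auto
    obtain w' where w': "w' \<in> carrier (sym_group n)" "ord w' = r" "(v, w') \<in> ?E \<or> v = w'"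
      by (rule sym_group_prime_power_elem[OF v(1) r])
    have "u = t \<or> (u, t) \<in> ?E"
      using sym_group_arcs_coprimeI[OF u(1) t(1) refl t(2) u(2) two_is_prime_nat] q by simp
    moreover have "t = w' \<or> (t, w') \<in> ?E"
      using sym_group_arcs_coprimeI[OF t(1) w'(1) t(2) w'(2) two_is_prime_nat r(1)] r2 by simp
    moreover have "w' = v \<or> (w', v) \<in> ?E"
      using w'(3) by (auto intro: sym)
    moreover have "t \<noteq> id" "w' \<noteq> id"
      using nonid t w' r by auto
    ultimately show ?thesis
      using t w' by blast
  qed
  show ?thesis
  proof (rule sym_group_ord_prime_cases[OF u v])
    fix q r assume *: "prime q" "q dvd ord u" "prime r" "r dvd ord v" "q = r \<or> q + r \<le> n"
    obtain w where w: "w \<in> carrier (sym_group n)" "ord w = q" "(u, w) \<in> ?E \<or> u = w"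
      by (rule sym_group_prime_power_elem[OF u(1) *(1,2)])
    obtain w' where w': "w' \<in> carrier (sym_group n)" "ord w' = r" "(v, w') \<in> ?E \<or> v = w'"
      by (rule sym_group_prime_power_elem[OF v(1) *(3,4)])
    have "w = w' \<or> (w, w') \<in> ?E"
      by (rule sym_group_arcs_coprimeI[OF w(1) w'(1) w(2) w'(2) *(1,3,5)])
    moreover have "w' = v \<or> (w', v) \<in> ?E"
      using w'(3) by (auto intro: sym)
    moreover have "w \<noteq> id" "w' \<noteq> id"
      using nonid w w' * by auto
    ultimately show ?thesis
      using w w' by blast
  next
    assume "prime (ord u)"
    then show ?thesis
      using prime_case[OF u(1) _ v] by simp
  next
    assume "prime (ord v)"
    \<comment> \<open>The prime case with \<open>u\<close> and \<open>v\<close> exchanged gives a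
      chain from \<open>v\<close> to \<open>u\<close>, to be read backwards.\<close>
    then obtain w w' where "w \<in> carrier (sym_group n) - {id}" "w' \<in> carrier (sym_group n) - {id}"
      "v = w \<or> (v, w) \<in> ?E" "w = w' \<or> (w, w') \<in> ?E" "w' = u \<or> (w', u) \<in> ?E"
      using prime_case[OF v(1) _ u] by auto
    then show ?thesis
      by (intro bexI[of _ w'] bexI[of _ w]) (auto intro: sym)
  qed
qed

section \<open>Two permutations without a common non-identity neighbour\<close>

text \<open>The elements \<open>c\<close> and \<open>x\<close> are a \<open>p\<^sup>l\<close>-cycle and an element whose order is a product of
  primes distinct from \<open>p\<close> that leaves no room for a further \<open>p\<close>-cycle.\<close>

lemma sym_group_far_pair:
  assumes p: "prime p" "l \<ge> 2" "n = p ^ l \<or> n = p ^ l + 1" and n: "3 \<le> n"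
  obtains c x where "c \<in> carrier (sym_group n)" "x \<in> carrier (sym_group n)" "x \<noteq> id"
    "p dvd group.ord (sym_group n) c" "\<not> p dvd group.ord (sym_group n) x"
    "\<And>w q. prime q \<Longrightarrow> q \<noteq> p \<Longrightarrow> q dvd group.ord (sym_group n) w \<Longrightarrow>
      (w, c) \<notin> order_super_commuting_arcs (sym_group n)"
    "\<And>w. p dvd group.ord (sym_group n) w \<Longrightarrow>
      (w, x) \<notin> order_super_commuting_arcs (sym_group n)"
proof -
  interpret group "sym_group n"
    by (rule sym_group_is_group)
  let ?E = "order_super_commuting_arcs (sym_group n)"
  have "\<exists>c\<in>carrier (sym_group n). ord c = \<Prod>{p ^ l}"
    using p by (intro ex_sym_group_ord_prod) (auto simp: prime_gt_0_nat)
  then obtain c where c: "c \<in> carrier (sym_group n)" "ord c = p ^ l"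
    by auto
  obtain S where S: "finite S" "\<forall>q\<in>S. prime q \<and> q \<noteq> p" "\<Sum>S \<le> n" "n < \<Sum>S + p"
    using prime_set_with_sum_near[OF p(1) n] by blast
  have coprime_S: "pairwise coprime S"
    using S by (auto simp: pairwise_def primes_coprime)
  have "\<exists>x\<in>carrier (sym_group n). ord x = \<Prod>S"
    using S coprime_S by (intro ex_sym_group_ord_prod) auto
  then obtain x where x: "x \<in> carrier (sym_group n)" "ord x = \<Prod>S"
    by auto
  \<comment> \<open>An empty \<open>S\<close> would give \<open>n < p\<close>, against
    \<open>n \<ge> p ^ l \<ge> p\<close>.\<close>
  have "S \<noteq> {}"
    using S(4) p self_le_power[of p l] prime_ge_2_nat[OF p(1)] by auto
  then obtain q where "q \<in> S"
    by blast
  then have "ord x \<noteq> 1"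
    using S dvd_prodI[OF S(1), of q "\<lambda>x. x"] x(2) by (metis nat_dvd_1_iff_1 not_prime_1)
  then have "x \<noteq> id"
    using ord_id by (auto simp: sym_group_one)
  have "coprime p (\<Prod>S)"
    using S p by (intro prod_coprime_right) (auto simp: primes_coprime)
  show thesis
  proof (rule that[OF c(1) x(1) \<open>x \<noteq> id\<close>])
    show "p dvd ord c"
      using c(2) p(2) by simp
    show "\<not> p dvd ord x"
      using \<open>coprime p (\<Prod>S)\<close> p(1) x(2) by (metis coprime_absorb_left not_prime_unit)
  next
    fix w q assume q: "prime q" "q \<noteq> p" "q dvd ord w"
    show "(w, c) \<notin> ?E"
    proof
      assume wc: "(w, c) \<in> ?E"
      then have "ord w \<noteq> 0"
        using sym_group_ord_pos[of w n] by (auto simp: order_super_commuting_arcs_def)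
      moreover have "coprime q (ord c)"
        using q p by (simp add: c primes_coprime)
      ultimately obtain z where z: "z \<in> carrier (sym_group n)" "q dvd ord z" "ord c dvd ord z"
        using order_super_commuting_arcsD[OF wc q(3)] by metis
      \<comment> \<open>Impossible, as \<open>n \<le> p ^ l + 1\<close> and
        \<open>q \<ge> 2\<close>.\<close>
      then have "q ^ 1 + p ^ l \<le> n"
        using p q c by (intro two_prime_powers_dvd_ord_le[of z]) (auto simp: sym_group_carrier)
      then show False
        using p(3) prime_ge_2_nat[OF q(1)] by auto
    qed
  next
    fix w assume "p dvd ord w"
    show "(w, x) \<notin> ?E"
    proof
      assume wx: "(w, x) \<in> ?E"
      then have "ord w \<noteq> 0"
        using sym_group_ord_pos[of w n] by (auto simp: order_super_commuting_arcs_def)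
      then obtain z where z: "z \<in> carrier (sym_group n)" "p dvd ord z" "ord x dvd ord z"
        using order_super_commuting_arcsD[OF wx \<open>p dvd ord w\<close>] \<open>coprime p (\<Prod>S)\<close> x(2) by metis
      have prime_S: "prime q" if "q \<in> insert p S" for q
        using that S(2) p(1) by blast
      have coprime_pS: "pairwise coprime (insert p S)"
        using coprime_S S p by (auto simp: pairwise_insert primes_coprime)
      have dvd: "q dvd ord z" if q: "q \<in> insert p S" for q
      proof (cases "q = p")
        case False
        then have "q dvd \<Prod>S"
          using q S(1) by (intro dvd_prodI[of S q "\<lambda>x. x"]) auto
        then show ?thesis
          using z(3) x(2) by (metis dvd_trans)
      qed (use z in simp)
      have prime_power: "\<exists>r e. prime r \<and> 0 < e \<and> q = r ^ e" if "q \<in> insert p S" for q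
        using prime_S[OF that] by (intro exI[of _ q] exI[of _ 1]) simp
      \<comment> \<open>This sum is \<open>\<Sum>S + p\<close>, which exceeds \<open>n\<close> by
        the choice of \<open>S\<close>.\<close>
      have "\<Sum>(insert p S) \<le> n"
      proof (rule sum_prime_powers_dvd_ord_le[of z n "insert p S"])
        show "z permutes {1..n}"
          using z(1) by (simp add: sym_group_carrier)
        show "finite (insert p S)"
          using S(1) by simp
        show "pairwise coprime (insert p S)"
          by (rule coprime_pS)
        show "\<exists>r e. prime r \<and> 0 < e \<and> q = r ^ e" if "q \<in> insert p S" for q
          using that by (rule prime_power)
        show "q dvd ord z" if "q \<in> insert p S" for q
          using that by (rule dvd)
      qed
      moreover have "p \<notin> S"
        using S by blast
      ultimately show False
        using S by simp
    qed
  qed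
qed

theorem corollary4p13:
  fixes n :: nat
  assumes "n \<ge> 4"
    and "\<not> prime n"
    and "\<not> prime (n - 1)"
    and "\<exists>p l. prime p \<and> l \<ge> 2 \<and> (n = p ^ l \<or> n = p ^ l + 1)"
  shows "Digraph_Component.connected (reduced_order_super_commuting_graph (sym_group n))
    \<and> wf_digraph.diameter (reduced_order_super_commuting_graph (sym_group n)) = 3"
proof -
  let ?G = "sym_group n"
  let ?E = "order_super_commuting_arcs ?G"
  let ?R = "reduced_order_super_commuting_graph ?G"
  interpret group ?G
    by (rule sym_group_is_group)
  have "finite (carrier ?G)"
    by (simp add: sym_group_def finite_permutations)
  then interpret R: wf_digraph ?R
    by (rule wf_digraph_reduced_order_super_commuting_graph)
  obtain p l where p: "prime p" "l \<ge> 2" "n = p ^ l \<or> n = p ^ l + 1"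
    using assms(4) by blast
  have "3 \<le> n"
    using assms(1) by simp
  obtain c x where c: "c \<in> carrier ?G" and x: "x \<in> carrier ?G" "x \<noteq> id"
    and dvd_c: "p dvd ord c" and not_dvd_x: "\<not> p dvd ord x"
    and not_c: "\<And>w q. prime q \<Longrightarrow> q \<noteq> p \<Longrightarrow> q dvd ord w \<Longrightarrow> (w, c) \<notin> ?E"
    and not_x: "\<And>w. p dvd ord w \<Longrightarrow> (w, x) \<notin> ?E"
    by (rule sym_group_far_pair[OF p \<open>3 \<le> n\<close>]) blast
  have prime_factor: "\<exists>q. prime q \<and> q dvd ord w" if "w \<in> carrier ?G" "w \<noteq> id" for w
    using that prime_factor_nat[of "ord w"] ord_eq_1[of w] by (auto simp: sym_group_one)
  \<comment> \<open>A prime divisor of \<open>ord w\<close> is either \<open>p\<close>, which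
    excludes \<open>x\<close>, or another prime, which excludes \<open>c\<close>.\<close>
  have not_both: "(w, c) \<notin> ?E \<or> (w, x) \<notin> ?E" if "w \<in> carrier ?G" "w \<noteq> id" for w
    using prime_factor[OF that] not_c not_x by metis
  have "c \<noteq> x"
    using dvd_c not_dvd_x by auto
  have nondominant: "w \<notin> dominant_verts (order_super_commuting_graph ?G)"
    if w: "w \<in> carrier ?G" "w \<noteq> id" for w
  proof
    assume "w \<in> dominant_verts (order_super_commuting_graph ?G)"
    then have E: "(w, v) \<in> ?E" if "v \<in> carrier ?G" "v \<noteq> w" for v
      using that by (simp add: dominant_verts_def)
    \<comment> \<open>Any other dominant \<open>w\<close> would be adjacent to both;
      \<open>c\<close> and \<open>x\<close> in turn are not adjacent to each other.\<close>
    have "w = c \<or> w = x"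
      using E[OF c] E[OF x(1)] not_both[OF w] by blast
    then show False
    proof
      assume "w = c"
      then show False
        using E[OF x(1)] \<open>c \<noteq> x\<close> not_x[OF dvd_c] by blast
    next
      assume "w = x"
      then show False
        using E[OF c] \<open>c \<noteq> x\<close> not_x[OF dvd_c] order_super_commuting_arcs_sym[of x c ?G] by simp
    qed
  qed
  then have verts: "verts ?R = carrier ?G - {id}"
    using one_dominant by (auto simp: verts_reduced_order_super_commuting_graph sym_group_one)
  have arc: "u \<rightarrow>\<^bsub>?R\<^esub> v \<longleftrightarrow> u \<in> carrier ?G - {id} \<and> v \<in> carrier ?G - {id} \<and> (u, v) \<in> ?E" for u v
    by (simp only: arcs_ends_reduced_order_super_commuting_graph verts)
  show ?thesis
  proof (rule R.connected_and_diameter_eq_3I)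
    fix u v assume "u \<in> verts ?R" "v \<in> verts ?R"
    then have uv: "u \<in> carrier ?G" "u \<noteq> id" "v \<in> carrier ?G" "v \<noteq> id"
      by (simp_all add: verts)
    from sym_group_chain[OF assms(2,3) this] obtain w w'
      where "w \<in> carrier ?G - {id}" "w' \<in> carrier ?G - {id}"
        "u = w \<or> (u, w) \<in> ?E" "w = w' \<or> (w, w') \<in> ?E" "w' = v \<or> (w', v) \<in> ?E"
      by auto
    then show "\<exists>p. R.awalk u p v \<and> length p \<le> 3"
      using uv by (intro R.ex_awalk_length_le_3[of u w w' v]) (simp_all add: verts arc)
  next
    show "c \<in> verts ?R"
      using c dvd_c p(1) ord_id by (auto simp: verts sym_group_one)
    show "x \<in> verts ?R"
      using x by (simp add: verts)
    show "3 \<le> R.distance c x"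
    proof (rule R.three_le_distance)
      show "\<not> c \<rightarrow>\<^bsub>?R\<^esub> x"
        using not_x[OF dvd_c] by (simp add: arc)
      show "\<not> w \<rightarrow>\<^bsub>?R\<^esub> x" if "c \<rightarrow>\<^bsub>?R\<^esub> w" for w
        using that not_both[of w] order_super_commuting_arcs_sym[of c w] by (auto simp: arc)
    qed fact
  qed
qed

end
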